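(* Let $f:\mathbb{N}\rightharpoonup\mathbb{N}$ be a partial function, and let $\mathcal{B}_f\subseteq\mathsf{P}$ be the set of all processes (of the Krivine machine with I/O) that implement $f$. Then: 1. the pole $\mathcal{B}_f$ is consistent if and only if $f$ is not totally undefined; 2. $\mathcal{B}_f$ is non-empty if and only if $f$ is computable.
   Context: Syntax. Terms: $t ::= x \mid \lambda x.\,t \mid t\,t \mid \mathsf{cc} \mid \mathsf{k}_\pi \mid \mathsf{r} \mid \mathsf{w1} \mid \mathsf{w0} \mid \mathsf{end}$, where $\pi$ is a stack and $\mathsf{cc},\mathsf{r},\mathsf{w0},\mathsf{w1},\mathsf{end}$ are constants. Stacks: $\pi ::= \varepsilon \mid t\cdot\pi$ with $t$ closed. Processes: $p ::= t\star\pi \mid \top$ with $t$ closed, $\pi$ a stack, and $\top$ a process constant. $\Lambda_e$, $\Pi_e$, $\mathsf{P}$ denote the sets of closed terms, stacks and processes. Evaluation relation $\succ$ on processes: $tu\star\pi\succ t\star u\cdot\pi$; $(\lambda x.\,t[x])\star u\cdot\pi\succ t[u]\star\pi$; $\mathsf{cc}\star t\cdot\pi\succ t\star\mathsf{k}_\pi\cdot\pi$; $\mathsf{k}_\pi\star t\cdot\rho\succ t\star\pi$. Execution contexts are triples $(p,\iota,o)$ with $p\in\mathsf{P}$ and $\iota,o\in\{0,1\}^*$ (input and output). The execution relation $\leadsto$ is given by: - $(t\star\pi,\iota,o)\leadsto(u\star\rho,\iota,o)$ whenever $t\star\pi\succ u\star\rho$; - $(\mathsf{r}\star t\cdot u\cdot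 v\cdot\pi,0\iota,o)\leadsto(t\star\pi,\iota,o)$; - $(\mathsf{r}\star t\cdot u\cdot v\cdot\pi,1\iota,o)\leadsto(u\star\pi,\iota,o)$; - $(\mathsf{r}\star t\cdot u\cdot v\cdot\pi,\varepsilon,o)\leadsto(v\star\pi,\varepsilon,o)$; - $(\mathsf{w0}\star t\cdot\pi,\iota,o)\leadsto(t\star\pi,\iota,0o)$; - $(\mathsf{w1}\star t\cdot\pi,\iota,o)\leadsto(t\star\pi,\iota,1o)$; - $(\mathsf{end}\star\pi,\iota,o)\leadsto(\top,\iota,o)$. $\leadsto^*$ is its reflexive-transitive closure. For $n\in\mathbb{N}$, $\mathrm{bin}(n)\in\{0,1\}^*$ is the base 2 representation of $n$ (most significant bit first, no leading zeros), with $\mathrm{bin}(0)=\varepsilon$; e.g. $\mathrm{bin}(1)=1$, $\mathrm{bin}(2)=10$. A process $p$ implements a partial function $f:\mathbb{N}\rightharpoonup\mathbb{N}$ if $(p,\mathrm{bin}(n),\varepsilon)\leadsto^*(\top,\varepsilon,\mathrm{bin}(f(n)))$ for all $n\in\mathrm{dom}(f)$ (no condition is imposed for $n\notin\mathrm{dom}(f)$). A pole is a set $\mathcal{B}\subseteq\mathsf{P}$ such that $p\in\mathcal{B}$ and $p'\succ p$ imply $p'\in\mathcal{B}$. The set $\mathsf{PL}\subseteq\Lambda_e$ of proof-like terms consists of the closed terms not containing any of $\mathsf{r},\mathsf{w0},\mathsf{w1},\mathsf{end}$. A pole $\mathcal{B}$ is consistent if for every $t\in\mathsf{PL}$ there is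 $\pi\in\Pi_e$ with $t\star\pi\notin\mathcal{B}$.
   Formalization: In item 2, "f is computable" is read as "f has a partial recursive extension"; with domain exactly dom(f) the claim fails: the identity on a non-r.e. set is implemented by any process computing the identity. For total f, or f with r.e. domain, this is the usual notion. *)

theory Defs
  imports Main
begin

(* Terms up to renaming of bound variables, as de Bruijn terms.  Kont \<pi> is the
   continuation constant of the stack \<pi>; that the elements of \<pi> are closed is
   imposed by closed_at below. *)

datatype trm =
    Var nat
  | Lam trm
  | App trm trm
  | Cc
  | Kont "trm list"
  | Rd
  | Wr1
  | Wr0
  | End

type_synonym stack = "trm list"

datatype process = Proc trm stack (infix "\<star>" 60) | Top

fun closed_at :: "nat \<Rightarrow> trm \<Rightarrow> bool" where
  "closed_at n (Var i) \<longleftrightarrow> i < n"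
| "closed_at n (Lam t) \<longleftrightarrow> closed_at (Suc n) t"
| "closed_at n (App t u) \<longleftrightarrow> closed_at n t \<and> closed_at n u"
| "closed_at n (Kont \<pi>) \<longleftrightarrow> (\<forall>t\<in>set \<pi>. closed_at 0 t)"
| "closed_at n _ \<longleftrightarrow> True"

definition closed_terms :: "trm set" where
  "closed_terms = {t. closed_at 0 t}"

definition stacks :: "stack set" where
  "stacks = lists closed_terms"

definition processes :: "process set" where
  "processes = insert Top {t \<star> \<pi> | t \<pi>. t \<in> closed_terms \<and> \<pi> \<in> stacks}"

(* subst k u t replaces the index k by u and closes the gap.  It is only used with
   u closed, so u is not shifted under binders; the stack in Kont \<pi> has no free
   variables, so it is left alone. *)

fun subst :: "nat \<Rightarrow> trm \<Rightarrow> trm \<Rightarrow> trm" where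
  "subst k u (Var i) = (if i < k then Var i else if i = k then u else Var (i - 1))"
| "subst k u (Lam t) = Lam (subst (Suc k) u t)"
| "subst k u (App s t) = App (subst k u s) (subst k u t)"
| "subst k u t = t"

inductive evaluates :: "process \<Rightarrow> process \<Rightarrow> bool" (infix "\<succ>" 50) where
  push: "App t u \<star> \<pi> \<succ> t \<star> u # \<pi>"
| grab: "Lam t \<star> u # \<pi> \<succ> subst 0 u t \<star> \<pi>"
| save: "Cc \<star> t # \<pi> \<succ> t \<star> Kont \<pi> # \<pi>"
| restore: "Kont \<pi> \<star> t # \<rho> \<succ> t \<star> \<pi>"

(* Bit strings are lists of booleans, True being the digit 1. *)

type_synonym exec_context = "process \<times> bool list \<times> bool list"

inductive executes :: "exec_context \<Rightarrow> exec_context \<Rightarrow> bool" (infix "\<leadsto>" 50) where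
  evaluate: "t \<star> \<pi> \<succ> u \<star> \<rho> \<Longrightarrow> (t \<star> \<pi>, inp, out) \<leadsto> (u \<star> \<rho>, inp, out)"
| read0: "(Rd \<star> t # u # v # \<pi>, False # inp, out) \<leadsto> (t \<star> \<pi>, inp, out)"
| read1: "(Rd \<star> t # u # v # \<pi>, True # inp, out) \<leadsto> (u \<star> \<pi>, inp, out)"
| read_empty: "(Rd \<star> t # u # v # \<pi>, [], out) \<leadsto> (v \<star> \<pi>, [], out)"
| write0: "(Wr0 \<star> t # \<pi>, inp, out) \<leadsto> (t \<star> \<pi>, inp, False # out)"
| write1: "(Wr1 \<star> t # \<pi>, inp, out) \<leadsto> (t \<star> \<pi>, inp, True # out)"
| halt: "(End \<star> \<pi>, inp, out) \<leadsto> (Top, inp, out)"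

fun bin :: "nat \<Rightarrow> bool list" where
  "bin n = (if n = 0 then [] else bin (n div 2) @ [odd n])"

declare bin.simps [simp del]

definition implements :: "process \<Rightarrow> (nat \<rightharpoonup> nat) \<Rightarrow> bool" where
  "implements p f \<longleftrightarrow>
     (\<forall>n m. f n = Some m \<longrightarrow> executes\<^sup>*\<^sup>* (p, bin n, []) (Top, [], bin m))"

definition implementations :: "(nat \<rightharpoonup> nat) \<Rightarrow> process set" where
  "implementations f = {p \<in> processes. implements p f}"

definition pole :: "process set \<Rightarrow> bool" where
  "pole B \<longleftrightarrow>
     B \<subseteq> processes \<and> (\<forall>p\<in>B. \<forall>p'\<in>processes. p' \<succ> p \<longrightarrow> p' \<in> B)"

fun io_free :: "trm \<Rightarrow> bool" where
  "io_free (Var i) \<longleftrightarrow> True"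
| "io_free (Lam t) \<longleftrightarrow> io_free t"
| "io_free (App t u) \<longleftrightarrow> io_free t \<and> io_free u"
| "io_free Cc \<longleftrightarrow> True"
| "io_free (Kont \<pi>) \<longleftrightarrow> (\<forall>t\<in>set \<pi>. io_free t)"
| "io_free Rd \<longleftrightarrow> False"
| "io_free Wr1 \<longleftrightarrow> False"
| "io_free Wr0 \<longleftrightarrow> False"
| "io_free End \<longleftrightarrow> False"

definition proof_like :: "trm set" where
  "proof_like = {t \<in> closed_terms. io_free t}"

definition consistent :: "process set \<Rightarrow> bool" where
  "consistent B \<longleftrightarrow> (\<forall>t\<in>proof_like. \<exists>\<pi>\<in>stacks. t \<star> \<pi> \<notin> B)"

lemma pole_implementations: "pole (implementations f)"
proof -
  have step: "(p', inp, out) \<leadsto> (p, inp, out)" if "p' \<succ> p" for p p' inp out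
    using that by cases (auto intro: executes.evaluate evaluates.intros)
  show ?thesis
    unfolding pole_def implementations_def implements_def
    by (auto intro: converse_rtranclp_into_rtranclp step)
qed

(* Kleene's partial recursive functions.  Codes carry no arity; a code applied to an
   argument list of unsuitable length has no value.  PrimRec recurses on, and Mu
   searches for, the first argument. *)

datatype recf =
    Zero
  | Succ
  | Proj nat
  | Comp recf "recf list"
  | PrimRec recf recf
  | Mu recf

inductive rec_eval :: "recf \<Rightarrow> nat list \<Rightarrow> nat \<Rightarrow> bool" where
  zero: "rec_eval Zero xs 0"
| succ: "rec_eval Succ [x] (Suc x)"
| proj: "i < length xs \<Longrightarrow> rec_eval (Proj i) xs (xs ! i)"
| comp: "list_all2 (\<lambda>g y. rec_eval g xs y) gs ys \<Longrightarrow> rec_eval h ys z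
           \<Longrightarrow> rec_eval (Comp h gs) xs z"
| primrec_0: "rec_eval g xs y \<Longrightarrow> rec_eval (PrimRec g h) (0 # xs) y"
| primrec_Suc: "rec_eval (PrimRec g h) (n # xs) y \<Longrightarrow> rec_eval h (n # y # xs) z
           \<Longrightarrow> rec_eval (PrimRec g h) (Suc n # xs) z"
| mu: "rec_eval g (n # xs) 0 \<Longrightarrow> (\<forall>m<n. \<exists>k. rec_eval g (m # xs) (Suc k))
           \<Longrightarrow> rec_eval (Mu g) xs n"

definition partial_recursive :: "(nat \<rightharpoonup> nat) \<Rightarrow> bool" where
  "partial_recursive g \<longleftrightarrow> (\<exists>c. \<forall>n m. g n = Some m \<longleftrightarrow> rec_eval c [n] m)"

(* Computability of f, like implementation of f by a process, asks for an algorithm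
   returning f n for every n in the domain of f and does not constrain its behaviour
   elsewhere.  (Without this convention the identity on a set that is not recursively
   enumerable would be implementable but not computable.) *)

definition computable :: "(nat \<rightharpoonup> nat) \<Rightarrow> bool" where
  "computable f \<longleftrightarrow> (\<exists>g. partial_recursive g \<and> f \<subseteq>\<^sub>m g)"

end

theory Submission
  imports Defs
begin

text \<open>
  Consistency. No rule of the machine brings in one of the four input/output constants, so a process
  made of a proof-like term and the empty stack never meets \<open>End\<close> and never reaches \<open>Top\<close>. As soon
  as \<open>f\<close> has a value, such a process cannot implement \<open>f\<close>. If \<open>f\<close> has no value, every process
  implements it.

  From recursive functions to processes. A code of a partial recursive function is compiled to a
  \<open>\<lambda>\<close>-term in continuation-passing style over Scott numerals and Scott lists (\<open>compile\<close>). Evaluation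
  is call-by-name, and continuation passing forces every number before it is used: a continuation
  always receives the canonical numeral itself, never a term that would still have to be evaluated to
  it. The reasoning is therefore purely syntactic (\<open>compile_returns\<close>), by induction on the evaluation
  of the code. Two loops turn this into a process on bit strings: one reads the input while doubling
  an accumulator (\<open>read_loop\<close>), the other writes the parity of the result and halves it
  (\<open>write_loop\<close>). The output grows at its front, so writing the least significant bit first gives
  the binary representation.

  From processes to recursive functions. Substitution is a recursion over terms. The simulation
  avoids it by an environment machine: terms are never rewritten, and a closure pairs the code of a
  term with the codes of closures for its free variables. One transition of that machine is a fixed
  case distinction built from pairing and projections (\<open>transition\<close>). It simulates the
  substitution machine (\<open>step_simulates\<close>), with the lookup of variables as the only
  additional steps. Searching for the first number of steps after which the machine has halted and
  returning the written number is a partial recursive function extending \<open>f\<close>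
  (\<open>implements_computable\<close>). Only this forward simulation matters, because the
  extension may behave in any way outside the domain of \<open>f\<close>.
\<close>

abbreviation runs (infix "\<leadsto>\<^sup>*" 50) where "x \<leadsto>\<^sup>* y \<equiv> executes\<^sup>*\<^sup>* x y"

section \<open>Consistency\<close>

lemma io_free_subst: "io_free t \<Longrightarrow> io_free u \<Longrightarrow> io_free (subst k u t)"
  by (induction k u t rule: subst.induct) auto

fun io_free_process :: "process \<Rightarrow> bool" where
  "io_free_process (t \<star> \<pi>) \<longleftrightarrow> io_free t \<and> (\<forall>u\<in>set \<pi>. io_free u)"
| "io_free_process Top \<longleftrightarrow> False"

lemma io_free_executes: "x \<leadsto> y \<Longrightarrow> io_free_process (fst x) \<Longrightarrow> io_free_process (fst y)"
  by (induction rule: executes.induct) (auto elim!: evaluates.cases intro: io_free_subst)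

lemma io_free_runs: "x \<leadsto>\<^sup>* y \<Longrightarrow> io_free_process (fst x) \<Longrightarrow> io_free_process (fst y)"
  by (induction rule: rtranclp_induct) (auto dest: io_free_executes)

lemma consistent_implementations_iff: "consistent (implementations f) \<longleftrightarrow> f \<noteq> Map.empty"
proof
  assume "consistent (implementations f)"
  moreover have "Cc \<in> proof_like" by (simp add: proof_like_def closed_terms_def)
  ultimately obtain \<pi> where "\<pi> \<in> stacks" "Cc \<star> \<pi> \<notin> implementations f"
    unfolding consistent_def by blast
  then show "f \<noteq> Map.empty"
    by (auto simp: implementations_def implements_def processes_def closed_terms_def)
next
  assume "f \<noteq> Map.empty"
  then obtain n m where nm: "f n = Some m" by (metis option.exhaust)
  have "t \<star> [] \<notin> implementations f" if "t \<in> proof_like" for t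
  proof
    assume "t \<star> [] \<in> implementations f"
    with nm have "(t \<star> [], bin n, []) \<leadsto>\<^sup>* (Top, [], bin m)"
      by (simp add: implementations_def implements_def)
    from io_free_runs[OF this] that show False by (simp add: proof_like_def)
  qed
  then show "consistent (implementations f)"
    unfolding consistent_def stacks_def by blast
qed

section \<open>Execution of closed terms\<close>

text \<open>
  Substitution never has to shift, and a closed term that has been substituted stays unaffected by
  later substitutions. The two simplification rules below express this; with them, concrete terms
  with closed parameters can be executed symbolically.
\<close>
lemma closed_at_mono: "closed_at m t \<Longrightarrow> m \<le> n \<Longrightarrow> closed_at n t"
  by (induction m t arbitrary: n rule: closed_at.induct) auto

lemma closed_at_Suc [simp]: "closed_at 0 t \<Longrightarrow> closed_at (Suc n) t"
  using closed_at_mono by blast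

lemma subst_above: "closed_at k t \<Longrightarrow> subst k u t = t"
  by (induction k t rule: closed_at.induct) auto

lemma subst_closed [simp]: "closed_at 0 t \<Longrightarrow> subst k u t = t"
  using subst_above closed_at_mono by blast

text \<open>
  The machine rules in the form of introduction rules that move a goal one step along the execution.
  Applied repeatedly, they execute a term until a variable or a call of an unknown term is in head
  position.
\<close>
lemma run_push: "(t \<star> u # \<pi>, i, w) \<leadsto>\<^sup>* q \<Longrightarrow> (App t u \<star> \<pi>, i, w) \<leadsto>\<^sup>* q"
  and run_grab: "(subst 0 u t \<star> \<pi>, i, w) \<leadsto>\<^sup>* q \<Longrightarrow> (Lam t \<star> u # \<pi>, i, w) \<leadsto>\<^sup>* q"
  and run_read0: "(t \<star> \<pi>, i, w) \<leadsto>\<^sup>* q \<Longrightarrow> (Rd \<star> t # u # v # \<pi>, False # i, w) \<leadsto>\<^sup>* q"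
  and run_read1: "(u \<star> \<pi>, i, w) \<leadsto>\<^sup>* q \<Longrightarrow> (Rd \<star> t # u # v # \<pi>, True # i, w) \<leadsto>\<^sup>* q"
  and run_read_empty: "(v \<star> \<pi>, [], w) \<leadsto>\<^sup>* q \<Longrightarrow> (Rd \<star> t # u # v # \<pi>, [], w) \<leadsto>\<^sup>* q"
  and run_write0: "(t \<star> \<pi>, i, False # w) \<leadsto>\<^sup>* q \<Longrightarrow> (Wr0 \<star> t # \<pi>, i, w) \<leadsto>\<^sup>* q"
  and run_write1: "(t \<star> \<pi>, i, True # w) \<leadsto>\<^sup>* q \<Longrightarrow> (Wr1 \<star> t # \<pi>, i, w) \<leadsto>\<^sup>* q"
  and run_halt: "(End \<star> \<pi>, i, w) \<leadsto>\<^sup>* (Top, i, w)"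
  by (blast intro: converse_rtranclp_into_rtranclp executes.intros evaluates.intros)+

lemmas run_intros = run_push run_grab run_read0 run_read1 run_read_empty run_write0 run_write1
  run_halt

section \<open>Compiling recursive functions\<close>

text \<open>
  Scott encodings: a number or list is its own case distinction, applied first to the branch for the
  empty case and then to the branch that receives the components. The arguments of \<open>suc_of\<close> and
  \<open>cons_of\<close> are placed under two binders, so a variable occurring in them must have its index raised
  by two. Since these are literally the constructors of \<open>num\<close> and \<open>lst\<close>, substituting canonical
  values yields a canonical value.
\<close>
definition suc_of :: "trm \<Rightarrow> trm" where "suc_of t = Lam (Lam (App (Var 0) t))"

definition cons_of :: "trm \<Rightarrow> trm \<Rightarrow> trm" where
  "cons_of x xs = Lam (Lam (App (App (Var 0) x) xs))"

fun num :: "nat \<Rightarrow> trm" where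
  "num 0 = Lam (Lam (Var 1))"
| "num (Suc n) = suc_of (num n)"

fun lst :: "nat list \<Rightarrow> trm" where
  "lst [] = Lam (Lam (Var 1))"
| "lst (x # xs) = cons_of (num x) (lst xs)"

lemma subst_suc_of [simp]: "subst k u (suc_of t) = suc_of (subst (Suc (Suc k)) u t)"
  by (simp add: suc_of_def)

lemma subst_cons_of [simp]:
  "subst k u (cons_of s t) = cons_of (subst (Suc (Suc k)) u s) (subst (Suc (Suc k)) u t)"
  by (simp add: cons_of_def)

lemma closed_suc_of [simp]: "closed_at k (suc_of t) = closed_at (Suc (Suc k)) t"
  by (simp add: suc_of_def)

lemma closed_cons_of [simp]:
  "closed_at k (cons_of s t) \<longleftrightarrow> closed_at (Suc (Suc k)) s \<and> closed_at (Suc (Suc k)) t"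
  by (simp add: cons_of_def)

lemma closed_num [simp]: "closed_at 0 (num n)"
  by (induction n) auto

lemma closed_lst [simp]: "closed_at 0 (lst xs)"
  by (induction xs) auto

lemma run_num_0: "(z \<star> \<pi>, i, w) \<leadsto>\<^sup>* q \<Longrightarrow> closed_at 0 z \<Longrightarrow> (num 0 \<star> z # s # \<pi>, i, w) \<leadsto>\<^sup>* q"
  by (auto intro!: run_intros)

lemma run_suc_of:
  "(s \<star> t # \<pi>, i, w) \<leadsto>\<^sup>* q \<Longrightarrow> closed_at 0 t \<Longrightarrow> closed_at 0 s \<Longrightarrow> (suc_of t \<star> z # s # \<pi>, i, w) \<leadsto>\<^sup>* q"
  by (auto intro!: run_intros simp: suc_of_def)

lemma run_cons_of:
  "(s \<star> t # ts # \<pi>, i, w) \<leadsto>\<^sup>* q \<Longrightarrow> closed_at 0 t \<Longrightarrow> closed_at 0 ts \<Longrightarrow> closed_at 0 s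
   \<Longrightarrow> (cons_of t ts \<star> z # s # \<pi>, i, w) \<leadsto>\<^sup>* q"
  by (auto intro!: run_intros simp: cons_of_def)

lemmas run_data = run_num_0 run_suc_of run_cons_of

text \<open>
  The calling convention of compiled code: a one-argument function hands its value to a continuation.
  The continuation has to be closed because it is substituted below binders without being shifted.
\<close>
definition returns :: "trm \<Rightarrow> trm \<Rightarrow> trm \<Rightarrow> bool" where
  "returns F a v \<longleftrightarrow>
     (\<forall>\<kappa> \<pi> i w. closed_at 0 \<kappa> \<longrightarrow> (F \<star> a # \<kappa> # \<pi>, i, w) \<leadsto>\<^sup>* (\<kappa> \<star> v # \<pi>, i, w))"

lemma run_call:
  "returns F a v \<Longrightarrow> (\<kappa> \<star> v # \<pi>, i, w) \<leadsto>\<^sup>* q \<Longrightarrow> closed_at 0 \<kappa> \<Longrightarrow> (F \<star> a # \<kappa> # \<pi>, i, w) \<leadsto>\<^sup>* q"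
  unfolding returns_def by (meson rtranclp_trans)

text \<open>
  In named form, \<open>\<lambda>l k. l _ (\<lambda>x r. k x)\<close> and \<open>\<lambda>l k. l _ (\<lambda>x r. proj_term i r k)\<close>. The branch for
  the empty list is never entered by a projection with a value, and \<open>Cc\<close> is an arbitrary closed term
  in its place.
\<close>
fun proj_term :: "nat \<Rightarrow> trm" where
  "proj_term 0 = Lam (Lam (App (App (Var 1) Cc) (Lam (Lam (App (Var 2) (Var 1))))))"
| "proj_term (Suc i) =
     Lam (Lam (App (App (Var 1) Cc) (Lam (Lam (App (App (proj_term i) (Var 0)) (Var 2))))))"

text \<open>
  The list of the values of several functions at one argument:
  \<open>\<lambda>l k. t l (\<lambda>y. args_term ts l (\<lambda>ys. k (y # ys)))\<close>.
\<close>
fun args_term :: "trm list \<Rightarrow> trm" where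
  "args_term [] = Lam (Lam (App (Var 0) (lst [])))"
| "args_term (t # ts) =
     Lam (Lam (App (App t (Var 1)) (Lam (App (App (args_term ts) (Var 2))
       (Lam (App (Var 2) (cons_of (Var 3) (Var 2))))))))"

text \<open>\<open>\<lambda>l k. args_term ts l (\<lambda>ys. h ys k)\<close>.\<close>
definition comp_term :: "trm \<Rightarrow> trm list \<Rightarrow> trm" where
  "comp_term h ts = Lam (Lam (App (App (args_term ts) (Var 1)) (Lam (App (App h (Var 0)) (Var 1)))))"

text \<open>
  Recursion comes from self-application: the first argument \<open>s\<close> of the step is the step itself. In
  named form,
  \<open>\<lambda>s l k. l _ (\<lambda>n xs. n (g xs k) (\<lambda>m. s s (m # xs) (\<lambda>y. h (m # y # xs) k)))\<close>.
\<close>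
definition rec_step :: "trm \<Rightarrow> trm \<Rightarrow> trm" where
  "rec_step g h =
    Lam (Lam (Lam (App (App (Var 1) Cc) (Lam (Lam
      (App (App (Var 1) (App (App g (Var 0)) (Var 2)))
        (Lam (App (App (App (Var 5) (Var 5)) (cons_of (Var 2) (Var 3)))
          (Lam (App (App h (cons_of (Var 3) (cons_of (Var 4) (Var 6)))) (Var 4)))))))))))"

text \<open>
  Unbounded search from \<open>n\<close> upwards, again by self-application:
  \<open>\<lambda>s n l k. g (n # l) (\<lambda>v. v (k n) (\<lambda>_. s s (Suc n) l k))\<close>.
\<close>
definition search_step :: "trm \<Rightarrow> trm" where
  "search_step g =
    Lam (Lam (Lam (Lam (App (App g (cons_of (Var 4) (Var 3)))
      (Lam (App (App (Var 0) (App (Var 1) (Var 3)))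
        (Lam (App (App (App (App (Var 5) (Var 5)) (suc_of (Var 6))) (Var 3)) (Var 2)))))))))"

fun compile :: "recf \<Rightarrow> trm" where
  "compile Zero = Lam (Lam (App (Var 0) (num 0)))"
| "compile Succ =
     Lam (Lam (App (App (Var 1) Cc) (Lam (Lam (App (Var 2) (suc_of (Var 3)))))))"
| "compile (Proj i) = proj_term i"
| "compile (Comp h gs) = comp_term (compile h) (map compile gs)"
| "compile (PrimRec g h) = App (rec_step (compile g) (compile h)) (rec_step (compile g) (compile h))"
| "compile (Mu g) = App (App (search_step (compile g)) (search_step (compile g))) (num 0)"

lemma closed_proj_term [simp]: "closed_at 0 (proj_term i)"
  by (induction i) auto

lemma closed_args_term [simp]: "\<forall>t\<in>set ts. closed_at 0 t \<Longrightarrow> closed_at 0 (args_term ts)"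
  by (induction ts) auto

lemma closed_rec_step [simp]: "closed_at 0 g \<Longrightarrow> closed_at 0 h \<Longrightarrow> closed_at 0 (rec_step g h)"
  by (simp add: rec_step_def)

lemma closed_search_step [simp]: "closed_at 0 g \<Longrightarrow> closed_at 0 (search_step g)"
  by (simp add: search_step_def)

lemma closed_compile [simp]: "closed_at 0 (compile c)"
  by (induction c) (auto simp: comp_term_def)

lemma proj_term_returns: "i < length xs \<Longrightarrow> returns (proj_term i) (lst xs) (num (xs ! i))"
proof (induction i arbitrary: xs)
  case 0
  then obtain y ys where "xs = y # ys" by (cases xs) auto
  then show ?case by (auto simp: returns_def intro!: run_intros run_data)
next
  case (Suc i)
  then obtain y ys where "xs = y # ys" "i < length ys" by (cases xs) auto
  then show ?case
    using run_call[OF Suc.IH] by (auto simp: returns_def intro!: run_intros run_data)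
qed

lemma args_term_returns:
  "list_all2 (\<lambda>t y. closed_at 0 t \<and> returns t (lst xs) (num y)) ts ys \<Longrightarrow>
   returns (args_term ts) (lst xs) (lst ys)"
proof (induction rule: list_all2_induct)
  case Nil
  show ?case by (auto simp: returns_def intro!: run_intros)
next
  case (Cons t ts y ys)
  from Cons.hyps have cl: "\<forall>t\<in>set ts. closed_at 0 t"
    by (auto simp: list_all2_conv_all_nth in_set_conv_nth)
  note call = run_call[OF conjunct2[OF Cons.hyps(1)]] run_call[OF Cons.IH]
  show ?case
    unfolding returns_def using cl Cons.hyps(1) by (auto intro!: run_intros call)
qed

text \<open>
  In the following four proofs \<open>subst\<close> unfolds the step only in head position. Its other copies, which
  wait on the stack, must stay folded: they are matched against the recursive call.
\<close>
lemma rec_step_returns_0: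
  assumes g: "returns g L v" and [simp]: "closed_at 0 g" "closed_at 0 h" "closed_at 0 L"
  shows "returns (App (rec_step g h) (rec_step g h)) (cons_of (num 0) L) v"
  apply (auto simp: returns_def simp del: num.simps intro!: run_intros)
  apply (subst rec_step_def)
  apply (auto simp del: num.simps intro!: run_intros run_data run_call[OF g])
  done

lemma rec_step_returns_Suc:
  assumes rec: "returns (App (rec_step g h) (rec_step g h)) (cons_of N L) y"
    and step: "returns h (cons_of N (cons_of y L)) z"
    and [simp]: "closed_at 0 g" "closed_at 0 h" "closed_at 0 N" "closed_at 0 L" "closed_at 0 y"
  shows "returns (App (rec_step g h) (rec_step g h)) (cons_of (suc_of N) L) z"
  unfolding returns_def
  apply (intro allI impI)
  apply (rule run_push)
  apply (subst rec_step_def)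
  apply (rule run_call[OF rec] run_call[OF step] run_push run_grab run_data | simp)+
  done

lemma search_step_returns_found:
  assumes g: "returns g (cons_of N L) (num 0)"
    and [simp]: "closed_at 0 g" "closed_at 0 N" "closed_at 0 L"
  shows "returns (App (App (search_step g) (search_step g)) N) L N"
  unfolding returns_def
  apply (intro allI impI)
  apply (rule run_push)+
  apply (subst search_step_def)
  apply (rule run_call[OF g] run_num_0 run_push run_grab rtranclp.rtrancl_refl | simp del: num.simps)+
  done

lemma search_step_returns_next:
  assumes g: "returns g (cons_of N L) (suc_of K)"
    and rec: "returns (App (App (search_step g) (search_step g)) (suc_of N)) L V"
    and [simp]: "closed_at 0 g" "closed_at 0 N" "closed_at 0 L" "closed_at 0 K" "closed_at 0 V"
  shows "returns (App (App (search_step g) (search_step g)) N) L V"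
  unfolding returns_def
  apply (intro allI impI)
  apply (rule run_push)+
  apply (subst search_step_def)
  apply (rule run_call[OF g] run_call[OF rec] run_data run_push run_grab rtranclp.rtrancl_refl | simp)+
  done

lemma compile_returns: "rec_eval c xs y \<Longrightarrow> returns (compile c) (lst xs) (num y)"
proof (induction rule: rec_eval.induct)
  case (zero xs)
  then show ?case by (auto simp: returns_def simp del: num.simps intro!: run_intros)
next
  case (succ x)
  then show ?case by (auto simp: returns_def intro!: run_intros run_data)
next
  case (proj i xs)
  then show ?case by (simp add: proj_term_returns)
next
  case (comp xs gs ys h z)
  have "list_all2 (\<lambda>t y. closed_at 0 t \<and> returns t (lst xs) (num y)) (map compile gs) ys"
    using comp.IH(1) by (auto simp: list_all2_conv_all_nth)
  note call = run_call[OF args_term_returns[OF this]] run_call[OF comp.IH(2)]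
  show ?case by (auto simp: returns_def comp_term_def intro!: run_intros call)
next
  case (primrec_0 g xs y h)
  then show ?case by (simp add: rec_step_returns_0 del: num.simps)
next
  case (primrec_Suc g h n xs y z)
  then show ?case by (simp add: rec_step_returns_Suc)
next
  case (mu g n xs)
  let ?search = "App (search_step (compile g)) (search_step (compile g))"
  \<comment> \<open>The search reaches its result from above: induction on the distance to the least zero.\<close>
  have "returns (App ?search (num (n - d))) (lst xs) (num n)" if "d \<le> n" for d
    using that
  proof (induction d)
    case 0
    then show ?case
      using mu.IH(1) by (simp add: search_step_returns_found del: num.simps(1))
  next
    case (Suc d)
    define m where "m = n - Suc d"
    have m: "m < n" "n - d = Suc m" using Suc.prems by (auto simp: m_def)
    then obtain k where "returns (compile g) (lst (m # xs)) (num (Suc k))"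
      using mu.IH(2) by auto
    moreover have "returns (App ?search (num (Suc m))) (lst xs) (num n)"
      using Suc.IH Suc.prems m by simp
    ultimately show ?case
      unfolding m_def[symmetric] by (auto intro: search_step_returns_next)
  qed
  from this[of n] show ?case by simp
qed

section \<open>Bit strings\<close>

text \<open>
  The strings here are binary numbers with leading zeros admitted, since a suffix of the input may
  start with a zero.
\<close>
definition val :: "bool list \<Rightarrow> nat" where
  "val = foldl (\<lambda>n b. 2 * n + of_bool b) 0"

lemma foldl_val: "foldl (\<lambda>n b. 2 * n + of_bool b) a bs = a * 2 ^ length bs + val bs"
proof (induction bs arbitrary: a)
  case Nil
  show ?case by (simp add: val_def)
next
  case (Cons b bs)
  have "val (b # bs) = of_bool b * 2 ^ length bs + val bs"
    using Cons.IH[of "of_bool b"] by (simp add: val_def)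
  then show ?case using Cons.IH[of "2 * a + of_bool b"] by (simp add: algebra_simps)
qed

lemma val_Cons [simp]: "val (b # bs) = of_bool b * 2 ^ length bs + val bs"
  using foldl_val[of "of_bool b" bs] by (simp add: val_def)

lemma val_Nil [simp]: "val [] = 0"
  by (simp add: val_def)

lemma val_less: "val bs < 2 ^ length bs"
  by (induction bs) auto

lemma val_bin: "val (bin n) = n"
proof (induction n rule: bin.induct)
  case (1 n)
  show ?case
  proof (cases "n = 0")
    case False
    with 1 have "val (bin (n div 2)) = n div 2" by simp
    moreover have "val (bin n) = 2 * val (bin (n div 2)) + of_bool (odd n)"
      using False by (subst bin.simps) (simp add: val_def)
    ultimately show ?thesis by simp
  qed (simp add: val_def bin.simps)
qed

section \<open>Reading and writing numbers\<close>

definition sing_of :: "trm \<Rightarrow> trm" where "sing_of t = cons_of t (lst [])"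

lemma subst_sing_of [simp]: "subst k u (sing_of t) = sing_of (subst (Suc (Suc k)) u t)"
  by (simp add: sing_of_def)

lemma closed_sing_of [simp]: "closed_at k (sing_of t) = closed_at (Suc (Suc k)) t"
  by (simp add: sing_of_def)

lemma compile_returns_sing:
  "rec_eval c [n] m \<Longrightarrow> returns (compile c) (sing_of (num n)) (num m)"
  using compile_returns[of c "[n]" m] by (simp add: sing_of_def)

text \<open>
  \<open>\<lambda>s n. Rd (d [n] (s s)) (e [n] (s s)) (b n)\<close>, where \<open>d\<close> and \<open>e\<close> append the bit just read to the
  accumulator \<open>n\<close>, and \<open>b\<close> takes over once the input is exhausted. Bits arrive most significant first.
\<close>
definition read_step :: "trm \<Rightarrow> trm \<Rightarrow> trm \<Rightarrow> trm" where
  "read_step d e b = Lam (Lam (App (App (App Rd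
     (App (App d (sing_of (Var 2))) (App (Var 1) (Var 1))))
     (App (App e (sing_of (Var 2))) (App (Var 1) (Var 1))))
     (App b (Var 0))))"

text \<open>
  \<open>\<lambda>s m. m End (\<lambda>_. p [m] (\<lambda>b. b (Wr0 (h [m] (s s))) (\<lambda>_. Wr1 (h [m] (s s)))))\<close>, where \<open>p\<close> computes the
  parity and \<open>h\<close> the half.
\<close>
definition write_step :: "trm \<Rightarrow> trm \<Rightarrow> trm" where
  "write_step p h = Lam (Lam (App (App (Var 0) End) (Lam (App (App p (sing_of (Var 3)))
     (Lam (App (App (Var 0)
       (App Wr0 (App (App h (sing_of (Var 4))) (App (Var 3) (Var 3)))))
       (Lam (App Wr1 (App (App h (sing_of (Var 5))) (App (Var 4) (Var 4)))))))))))"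

lemma closed_read_step [simp]:
  "closed_at 0 d \<Longrightarrow> closed_at 0 e \<Longrightarrow> closed_at 0 b \<Longrightarrow> closed_at 0 (read_step d e b)"
  by (simp add: read_step_def)

lemma closed_write_step [simp]:
  "closed_at 0 p \<Longrightarrow> closed_at 0 h \<Longrightarrow> closed_at 0 (write_step p h)"
  by (simp add: write_step_def)

lemma read_loop:
  fixes d e b
  assumes d: "\<And>n. returns d (sing_of (num n)) (num (2 * n))"
    and e: "\<And>n. returns e (sing_of (num n)) (num (Suc (2 * n)))"
    and [simp]: "closed_at 0 d" "closed_at 0 e" "closed_at 0 b"
  defines "R \<equiv> read_step d e b"
  shows "(R \<star> R # num n # \<pi>, bs, w) \<leadsto>\<^sup>* (b \<star> num (foldl (\<lambda>n b. 2 * n + of_bool b) n bs) # \<pi>, [], w)"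
proof (induction bs arbitrary: n)
  case Nil
  have [simp]: "closed_at 0 R" by (simp add: R_def)
  show ?case
    apply (subst R_def)
    apply (subst read_step_def)
    apply (rule run_push run_grab run_read_empty rtranclp.rtrancl_refl | simp)+
    done
next
  case (Cons a bs)
  have [simp]: "closed_at 0 R" by (simp add: R_def)
  show ?case
    apply (subst R_def)
    apply (subst read_step_def)
    apply (cases a)
    apply (rule run_call[OF d] run_call[OF e] run_push run_grab run_read0 run_read1
      Cons.IH[THEN rtranclp_trans] rtranclp.rtrancl_refl | simp)+
    done
qed

text \<open>
  Every write puts its bit in front of those written before, so the parities of \<open>m\<close>, \<open>m div 2\<close>,
  and so on end up in the order of \<open>bin m\<close>.
\<close>
lemma write_loop:
  fixes p h
  assumes p: "\<And>n. returns p (sing_of (num n)) (num (n mod 2))"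
    and h: "\<And>n. returns h (sing_of (num n)) (num (n div 2))"
    and [simp]: "closed_at 0 p" "closed_at 0 h"
  defines "W \<equiv> write_step p h"
  shows "(W \<star> W # num m # \<pi>, i, w) \<leadsto>\<^sup>* (Top, i, bin m @ w)"
proof (induction m arbitrary: w rule: bin.induct)
  case (1 m)
  have [simp]: "closed_at 0 W" by (simp add: W_def)
  show ?case
  proof (cases m)
    case 0
    show ?thesis
      unfolding 0
      apply (subst W_def)
      apply (subst write_step_def)
      apply (rule run_push run_grab run_num_0 run_halt | simp add: bin.simps del: num.simps)+
      done
  next
    case (Suc k)
    have num_m: "num m = suc_of (num k)" by (simp add: Suc)
    have bin_m: "bin m = bin (m div 2) @ [odd m]" using Suc by (subst bin.simps) simp
    \<comment> \<open>From the call of the loop to the case distinction on the parity, common to both cases.\<close>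
    have start: "(W \<star> W # num m # \<pi>, i, w) \<leadsto>\<^sup>* q" if
      "(num (m mod 2) \<star> App Wr0 (App (App h (sing_of (num m))) (App W W)) #
        Lam (App Wr1 (App (App h (sing_of (num m))) (App W W))) # \<pi>, i, w) \<leadsto>\<^sup>* q" for q
      apply (subst W_def)
      apply (subst write_step_def)
      apply (rule run_push run_grab | simp del: num.simps)+
      apply (subst num_m)
      apply (rule run_call[OF p] run_push run_grab run_suc_of | simp del: num.simps)+
      using that
      apply simp_all
      done
    have IH: "(W \<star> W # num (m div 2) # \<pi>, i, w) \<leadsto>\<^sup>* (Top, i, bin (m div 2) @ w)" for w
      using 1 Suc by simp
    show ?thesis
    proof (rule start, cases "odd m")
      case True
      then have eq: "num (m mod 2) = suc_of (num 0)" by (simp add: odd_iff_mod_2_eq_one)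
      show "(num (m mod 2) \<star> App Wr0 (App (App h (sing_of (num m))) (App W W)) #
        Lam (App Wr1 (App (App h (sing_of (num m))) (App W W))) # \<pi>, i, w) \<leadsto>\<^sup>* (Top, i, bin m @ w)"
        unfolding eq bin_m using True IH[of "True # w"]
        by (auto intro!: run_suc_of run_grab run_push run_write1 run_call[OF h] simp del: num.simps)
    next
      case False
      then have eq: "num (m mod 2) = num 0" by (simp add: even_iff_mod_2_eq_zero)
      show "(num (m mod 2) \<star> App Wr0 (App (App h (sing_of (num m))) (App W W)) #
        Lam (App Wr1 (App (App h (sing_of (num m))) (App W W))) # \<pi>, i, w) \<leadsto>\<^sup>* (Top, i, bin m @ w)"
        unfolding eq bin_m using False IH[of "False # w"]
        by (auto intro!: run_num_0 run_push run_write0 run_call[OF h] simp del: num.simps)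
    qed
  qed
qed

section \<open>Total recursive functions\<close>

text \<open>
  Functions on lists of a fixed length, given extensionally. The closure properties below then act as
  introduction rules on \<open>\<lambda>\<close>-abstractions, so a composite function is shown recursive by following its
  syntax and no code is ever written down.
\<close>
definition rec_fun :: "nat \<Rightarrow> (nat list \<Rightarrow> nat) \<Rightarrow> bool" where
  "rec_fun k F \<longleftrightarrow> (\<exists>c. \<forall>xs. length xs = k \<longrightarrow> rec_eval c xs (F xs))"

abbreviation "rec_fun1 f \<equiv> rec_fun 1 (\<lambda>xs. f (xs ! 0))"
abbreviation "rec_fun2 f \<equiv> rec_fun 2 (\<lambda>xs. f (xs ! 0) (xs ! 1))"

lemma rec_fun_nth: "i < k \<Longrightarrow> rec_fun k (\<lambda>xs. xs ! i)"
  unfolding rec_fun_def by (auto intro!: exI[of _ "Proj i"] rec_eval.proj)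

lemma rec_fun_compose:
  assumes "rec_fun (length Gs) F" and "\<forall>G\<in>set Gs. rec_fun k G"
  shows "rec_fun k (\<lambda>xs. F (map (\<lambda>G. G xs) Gs))"
proof -
  obtain c where c: "\<And>ys. length ys = length Gs \<Longrightarrow> rec_eval c ys (F ys)"
    using assms(1) by (auto simp: rec_fun_def)
  obtain d where d: "\<And>G xs. G \<in> set Gs \<Longrightarrow> length xs = k \<Longrightarrow> rec_eval (d G) xs (G xs)"
    using assms(2) unfolding rec_fun_def by metis
  have "rec_eval (Comp c (map d Gs)) xs (F (map (\<lambda>G. G xs) Gs))" if "length xs = k" for xs
    using that by (auto intro!: rec_eval.comp[where ys = "map (\<lambda>G. G xs) Gs"] c d
      simp: list_all2_conv_all_nth)
  then show ?thesis unfolding rec_fun_def by blast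
qed

lemma rec_fun_app1: "rec_fun1 f \<Longrightarrow> rec_fun k F \<Longrightarrow> rec_fun k (\<lambda>xs. f (F xs))"
  using rec_fun_compose[of "[F]"] by fastforce

lemma rec_fun_app2:
  "rec_fun2 f \<Longrightarrow> rec_fun k F \<Longrightarrow> rec_fun k G \<Longrightarrow> rec_fun k (\<lambda>xs. f (F xs) (G xs))"
  using rec_fun_compose[of "[F, G]"] by (fastforce simp: numeral_2_eq_2)

lemma rec_fun_Suc: "rec_fun1 Suc"
  unfolding rec_fun_def
  by (intro exI[of _ Succ]) (auto simp: length_Suc_conv intro: rec_eval.succ)

lemma rec_fun_const: "rec_fun k (\<lambda>_. c)"
proof (induction c)
  case 0
  then show ?case by (auto simp: rec_fun_def intro: rec_eval.zero)
next
  case (Suc c)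
  then show ?case by (rule rec_fun_app1[OF rec_fun_Suc])
qed

text \<open>Primitive recursion on the first argument, the remaining arguments being parameters.\<close>
lemma rec_fun_rec:
  assumes "rec_fun k G" and "rec_fun (Suc (Suc k)) (\<lambda>xs. H (xs ! 0) (xs ! 1) (drop 2 xs))"
  shows "rec_fun (Suc k) (\<lambda>xs. rec_nat (G (tl xs)) (\<lambda>n y. H n y (tl xs)) (xs ! 0))"
proof -
  obtain g where g: "\<And>xs. length xs = k \<Longrightarrow> rec_eval g xs (G xs)"
    using assms(1) by (auto simp: rec_fun_def)
  obtain h where h: "\<And>xs. length xs = Suc (Suc k) \<Longrightarrow> rec_eval h xs (H (xs ! 0) (xs ! 1) (drop 2 xs))"
    using assms(2) by (auto simp: rec_fun_def)
  have "rec_eval (PrimRec g h) (n # xs) (rec_nat (G xs) (\<lambda>n y. H n y xs) n)"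
    if "length xs = k" for n xs
  proof (induction n)
    case 0
    then show ?case using g that by (auto intro: rec_eval.primrec_0)
  next
    case (Suc n)
    show ?case
      using rec_eval.primrec_Suc[OF Suc.IH] h[of "n # _ # xs"] that by simp
  qed
  then show ?thesis
    unfolding rec_fun_def by (intro exI[of _ "PrimRec g h"]) (auto simp: length_Suc_conv)
qed

lemma rec_fun_rec1:
  assumes h: "rec_fun2 h" and f: "f 0 = a" "\<And>n. f (Suc n) = h n (f n)"
  shows "rec_fun1 f"
proof -
  have "f n = rec_nat a h n" for n
    by (induction n) (simp_all add: f)
  then show ?thesis
    using rec_fun_rec[of 0 "\<lambda>_. a" "\<lambda>n y _. h n y"] h
    by (simp add: rec_fun_const numeral_2_eq_2)
qed

lemma rec_fun_rec2:
  assumes g: "rec_fun1 g" and h: "rec_fun 3 (\<lambda>xs. h (xs ! 0) (xs ! 1) (xs ! 2))"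
    and f: "\<And>x. f 0 x = g x" "\<And>n x. f (Suc n) x = h n (f n x) x"
  shows "rec_fun2 f"
proof -
  have f_rec: "f n x = rec_nat (g x) (\<lambda>n y. h n y x) n" for n x
    by (induction n) (simp_all add: f)
  have "rec_fun (Suc 1) (\<lambda>xs. rec_nat (g (tl xs ! 0)) (\<lambda>n y. h n y (tl xs ! 0)) (xs ! 0))"
    using h by (intro rec_fun_rec[OF g]) (simp add: rec_fun_def numeral_2_eq_2 numeral_3_eq_3)
  moreover have "tl xs ! 0 = xs ! 1" if "length xs = 2" for xs :: "nat list"
    using that by (simp add: nth_tl)
  ultimately show ?thesis unfolding rec_fun_def f_rec by (simp add: numeral_2_eq_2)
qed

lemmas rec_fun_base = rec_fun_nth rec_fun_const rec_fun_app1[OF rec_fun_Suc]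

lemma rec_fun_plus: "rec_fun2 (+)"
  by (rule rec_fun_rec2[where g = "\<lambda>x. x" and h = "\<lambda>n y x. Suc y"])
    (auto intro!: rec_fun_base)

lemma rec_fun_times: "rec_fun2 (*)"
  by (rule rec_fun_rec2[where g = "\<lambda>x. 0" and h = "\<lambda>n y x. y + x"])
    (auto intro!: rec_fun_base rec_fun_app2[OF rec_fun_plus])

lemma rec_fun_pred: "rec_fun1 (\<lambda>n. n - 1)"
  by (rule rec_fun_rec1[where a = 0 and h = "\<lambda>n y. n"]) (auto intro!: rec_fun_base)

lemma rec_fun_minus: "rec_fun2 (-)"
proof -
  have "rec_fun2 (\<lambda>n x. x - n)"
  proof (rule rec_fun_rec2)
    show "rec_fun1 (\<lambda>x. x)" by (rule rec_fun_nth) simp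
    show "rec_fun 3 (\<lambda>xs. xs ! 1 - 1)"
      by (intro rec_fun_app1[OF rec_fun_pred] rec_fun_nth) simp
  qed simp_all
  from rec_fun_app2[OF this, of 2 "\<lambda>xs. xs ! 1" "\<lambda>xs. xs ! 0"] show ?thesis
    by (simp add: rec_fun_nth)
qed

lemmas rec_fun_arith = rec_fun_base rec_fun_app2[OF rec_fun_plus] rec_fun_app2[OF rec_fun_times]
  rec_fun_app2[OF rec_fun_minus]

lemma rec_fun_if_0:
  assumes "rec_fun k C" "rec_fun k A" "rec_fun k B"
  shows "rec_fun k (\<lambda>xs. if C xs = 0 then A xs else B xs)"
proof -
  \<comment> \<open>Truncated subtraction from 1 tests for zero.\<close>
  have "(\<lambda>xs. if C xs = 0 then A xs else B xs) =
        (\<lambda>xs. (1 - C xs) * A xs + (1 - (1 - C xs)) * B xs)" by auto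
  moreover have "rec_fun k \<dots>" by (intro rec_fun_arith assms)
  ultimately show ?thesis by (simp only:)
qed

lemma rec_fun_if_eq:
  assumes "rec_fun k C" "rec_fun k D" "rec_fun k A" "rec_fun k B"
  shows "rec_fun k (\<lambda>xs. if C xs = D xs then A xs else B xs)"
proof -
  have "(\<lambda>xs. if C xs = D xs then A xs else B xs) =
        (\<lambda>xs. if (C xs - D xs) + (D xs - C xs) = 0 then A xs else B xs)" by auto
  moreover have "rec_fun k \<dots>" by (intro rec_fun_arith rec_fun_if_0 assms)
  ultimately show ?thesis by (simp only:)
qed

lemma rec_fun_div_2: "rec_fun1 (\<lambda>n. n div 2)"
proof (rule rec_fun_rec1[where a = 0 and h = "\<lambda>n y. n - y"])
  show "Suc n div 2 = n - n div 2" for n by presburger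
  show "rec_fun2 (-)" by (rule rec_fun_minus)
qed simp

section \<open>Recursive pairing\<close>

text \<open>
  Any pairing with recursive projections would do. For this one \<open>a + b\<close> is the integer square root of
  \<open>pair a b\<close>, because \<open>a < 2 * (a + b) + 1\<close>, and the integer square root is a simple primitive
  recursion. The pairing is not surjective.
\<close>
definition pair :: "nat \<Rightarrow> nat \<Rightarrow> nat" where "pair a b = (a + b) * (a + b) + a"

fun root :: "nat \<Rightarrow> nat" where
  "root 0 = 0"
| "root (Suc z) = (if Suc (root z) * Suc (root z) = Suc z then Suc (root z) else root z)"

definition left :: "nat \<Rightarrow> nat" where "left z = z - root z * root z"

definition right :: "nat \<Rightarrow> nat" where "right z = root z - left z"

lemma root_bounds: "root z * root z \<le> z \<and> z < Suc (root z) * Suc (root z)"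
proof (induction z)
  case (Suc z)
  define r where "r = root z"
  show ?case
  proof (cases "Suc r * Suc r = Suc z")
    case True
    moreover have "Suc r * Suc r < Suc (Suc r) * Suc (Suc r)" by (intro mult_strict_mono) simp_all
    ultimately show ?thesis by (simp only: root.simps flip: r_def) (simp del: mult_Suc mult_Suc_right)
  next
    case False
    then show ?thesis
      using Suc by (simp only: root.simps flip: r_def) (simp del: mult_Suc mult_Suc_right)
  qed
qed simp

lemma root_unique:
  assumes "r * r \<le> z" and "z < Suc r * Suc r"
  shows "root z = r"
proof -
  have "a \<le> b" if "a * a \<le> z" "z < Suc b * Suc b" for a b
  proof (rule ccontr)
    assume "\<not> a \<le> b"
    then have "Suc b * Suc b \<le> a * a" by (intro mult_le_mono) auto
    with that show False by linarith
  qed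
  then show ?thesis using root_bounds[of z] assms by (blast intro: le_antisym)
qed

lemma root_pair: "root (pair a b) = a + b"
  by (rule root_unique) (auto simp: pair_def)

lemma left_pair [simp]: "left (pair a b) = a"
  and right_pair [simp]: "right (pair a b) = b"
  by (simp_all add: left_def right_def root_pair) (simp_all add: pair_def)

lemma rec_fun_pair: "rec_fun2 pair"
  unfolding pair_def by (intro rec_fun_arith) auto

lemma rec_fun_root: "rec_fun1 root"
proof (rule rec_fun_rec1)
  show "rec_fun2 (\<lambda>z r. if Suc r * Suc r = Suc z then Suc r else r)"
    by (intro rec_fun_arith rec_fun_if_eq) auto
qed auto

lemma rec_fun_left: "rec_fun1 left" and rec_fun_right: "rec_fun1 right"
  unfolding left_def right_def by (intro rec_fun_arith rec_fun_app1[OF rec_fun_root]; simp)+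

lemmas rec_fun_intros = rec_fun_arith rec_fun_if_0 rec_fun_if_eq rec_fun_app1[OF rec_fun_div_2]
  rec_fun_app2[OF rec_fun_pair] rec_fun_app1[OF rec_fun_left] rec_fun_app1[OF rec_fun_right]

fun list_code :: "nat list \<Rightarrow> nat" where
  "list_code [] = 0"
| "list_code (x # xs) = Suc (pair x (list_code xs))"

section \<open>From recursive functions to processes\<close>

text \<open>Recursive functions as closed terms.\<close>
lemma rec_fun1_term:
  assumes "rec_fun1 h"
  obtains t where "closed_at 0 t" "\<And>n. returns t (sing_of (num n)) (num (h n))"
proof -
  from assms obtain c where "\<forall>xs. length xs = 1 \<longrightarrow> rec_eval c xs (h (xs ! 0))"
    unfolding rec_fun_def by blast
  then have "rec_eval c [n] (h n)" for n by (auto dest: spec[of _ "[n]"])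
  with that[of "compile c"] compile_returns_sing show thesis by simp
qed

lemma computable_implementations:
  assumes "computable f"
  shows "implementations f \<noteq> {}"
proof -
  from assms obtain g c where g: "f \<subseteq>\<^sub>m g" "\<And>n m. g n = Some m \<longleftrightarrow> rec_eval c [n] m"
    unfolding computable_def partial_recursive_def by metis
  have "rec_fun1 (\<lambda>n. 2 * n)" by (intro rec_fun_intros) simp
  then obtain d where d: "closed_at 0 d" "\<And>n. returns d (sing_of (num n)) (num (2 * n))"
    by (rule rec_fun1_term) blast
  have "rec_fun1 (\<lambda>n. Suc (2 * n))" by (intro rec_fun_intros) simp
  then obtain e where e: "closed_at 0 e" "\<And>n. returns e (sing_of (num n)) (num (Suc (2 * n)))"
    by (rule rec_fun1_term) blast
  obtain h where h: "closed_at 0 h" "\<And>n. returns h (sing_of (num n)) (num (n div 2))"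
    using rec_fun_div_2 by (rule rec_fun1_term) blast
  have "rec_fun1 (\<lambda>n. n - n div 2 * 2)" by (intro rec_fun_intros) simp_all
  then have "rec_fun1 (\<lambda>n. n mod 2)" by (simp add: minus_div_mult_eq_mod)
  then obtain p where p: "closed_at 0 p" "\<And>n. returns p (sing_of (num n)) (num (n mod 2))"
    by (rule rec_fun1_term) blast
  define W where "W = write_step p h"
  define b where "b = Lam (App (App (compile c) (sing_of (Var 2))) (App W W))"
  define R where "R = read_step d e b"
  have W: "closed_at 0 W" using p h by (simp add: W_def)
  then have b: "closed_at 0 b" by (simp add: b_def)
  with d e have R: "closed_at 0 R" by (simp add: R_def)
  have "(R \<star> [R, num 0], bin n, []) \<leadsto>\<^sup>* (Top, [], bin m)" if "f n = Some m" for n m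
  proof -
    from that g(1) have "g n = Some m" by (metis domI map_le_def)
    with g(2) have main: "returns (compile c) (sing_of (num n)) (num m)"
      by (simp add: compile_returns_sing)
    have "(R \<star> [R, num 0], bin n, []) \<leadsto>\<^sup>* (b \<star> [num n], [], [])"
      using read_loop[OF d(2) e(2) d(1) e(1) b, of 0 "[]" "bin n" "[]"] val_bin[of n]
      unfolding R_def val_def by simp
    also have "(b \<star> [num n], [], []) \<leadsto>\<^sup>* (W \<star> [W, num m], [], [])"
      unfolding b_def using W
      by (auto intro!: run_grab run_push[of _ "sing_of _"] run_push[of _ "App W W"] run_call[OF main]
          run_push[of W W])
    also have "(W \<star> [W, num m], [], []) \<leadsto>\<^sup>* (Top, [], bin m)"
      using write_loop[OF p(2) h(2) p(1) h(1), of m "[]" "[]" "[]"] by (simp add: W_def)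
    finally show ?thesis .
  qed
  moreover have "R \<star> [R, num 0] \<in> processes"
    using R by (simp add: processes_def closed_terms_def stacks_def)
  ultimately show ?thesis unfolding implementations_def implements_def by blast
qed

section \<open>The environment machine\<close>

text \<open>
  Simultaneous substitution of an environment of closed terms for the variables from \<open>k\<close> on. It is
  the meaning of a closure.
\<close>
fun inst :: "nat \<Rightarrow> trm list \<Rightarrow> trm \<Rightarrow> trm" where
  "inst k us (Var i) = (if i < k \<or> k + length us \<le> i then Var i else us ! (i - k))"
| "inst k us (Lam t) = Lam (inst (Suc k) us t)"
| "inst k us (App s t) = App (inst k us s) (inst k us t)"
| "inst k us t = t"

lemma inst_Nil [simp]: "inst k [] t = t"
  by (induction k "[] :: trm list" t rule: inst.induct) auto

lemma closed_inst:
  "closed_at (k + length us) t \<Longrightarrow> \<forall>u\<in>set us. closed_at 0 u \<Longrightarrow> closed_at k (inst k us t)"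
  by (induction k us t rule: inst.induct) (auto intro: closed_at_mono)

text \<open>Why pushing the argument on the environment implements the \<open>grab\<close> rule.\<close>
lemma subst_inst:
  "closed_at (Suc (k + length us)) t \<Longrightarrow> \<forall>u\<in>set us. closed_at 0 u \<Longrightarrow>
   subst k u (inst (Suc k) us t) = inst k (u # us) t"
proof (induction k us t arbitrary: rule: inst.induct)
  case (1 k us i)
  then show ?case by (auto simp: nth_Cons' not_less less_Suc_eq)
qed auto

text \<open>
  The stack of a continuation constant is stored as the environment machine wants it, as a list of
  closures with empty environment (the second component 0). Restoring it is then a mere projection.
\<close>
fun enc :: "trm \<Rightarrow> nat" where
  "enc (Var i) = pair 0 i"
| "enc (Lam t) = pair 1 (enc t)"
| "enc (App t u) = pair 2 (pair (enc t) (enc u))"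
| "enc Cc = pair 3 0"
| "enc (Kont \<pi>) = pair 4 (list_code (map (\<lambda>t. pair (enc t) 0) \<pi>))"
| "enc Rd = pair 5 0"
| "enc Wr1 = pair 6 0"
| "enc Wr0 = pair 7 0"
| "enc End = pair 8 0"

text \<open>
  Continuations captured at run time hold arbitrary closures instead of encoded terms; the second rule
  covers them.
\<close>
inductive represents :: "nat \<Rightarrow> trm \<Rightarrow> bool" where
  closure: "list_all2 represents es us \<Longrightarrow> closed_at (length us) t
    \<Longrightarrow> represents (pair (enc t) (list_code es)) (inst 0 us t)"
| continuation: "list_all2 represents cs \<pi>
    \<Longrightarrow> represents (pair (pair 4 (list_code cs)) e) (Kont \<pi>)"

lemma represents_closed: "represents c t \<Longrightarrow> closed_at 0 t"
proof (induction rule: represents.induct)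
  case (closure es us t)
  then have "\<forall>u\<in>set us. closed_at 0 u" by (auto simp: list_all2_conv_all_nth in_set_conv_nth)
  then show ?case using closure.hyps by (intro closed_inst) auto
next
  case (continuation cs \<pi> e)
  then show ?case by (auto simp: list_all2_conv_all_nth in_set_conv_nth)
qed

lemma represents_all_closed: "list_all2 represents cs us \<Longrightarrow> \<forall>u\<in>set us. closed_at 0 u"
  by (induction rule: list_all2_induct) (auto dest: represents_closed)

lemma represents_enc: "closed_at 0 t \<Longrightarrow> represents (pair (enc t) 0) t"
  using represents.closure[of "[]" "[]" t] by simp

lemma represents_enc_all:
  "\<forall>t\<in>set ts. closed_at 0 t \<Longrightarrow> list_all2 represents (map (\<lambda>t. pair (enc t) 0) ts) ts"
  by (auto simp: list_all2_conv_all_nth intro!: represents_enc)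

definition head :: "nat \<Rightarrow> nat" where "head s = left (s - 1)"

definition tail :: "nat \<Rightarrow> nat" where "tail s = right (s - 1)"

lemma head_Suc_pair [simp]: "head (Suc (pair x s)) = x"
  and tail_Suc_pair [simp]: "tail (Suc (pair x s)) = s"
  by (simp_all add: head_def tail_def)

definition tag :: "nat \<Rightarrow> nat" where "tag c = left (left c)"

definition arg :: "nat \<Rightarrow> nat" where "arg c = right (left c)"

lemma tag_pair [simp]: "tag (pair (pair t a) e) = t"
  and arg_pair [simp]: "arg (pair (pair t a) e) = a"
  by (simp_all add: tag_def arg_def)

definition state :: "nat \<Rightarrow> nat \<Rightarrow> nat \<Rightarrow> nat \<Rightarrow> nat" where
  "state c s i w = pair c (pair s (pair i w))"

definition written :: "nat \<Rightarrow> nat" where "written z = right (right (right z))"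

lemma left_state [simp]: "left (state c s i w) = c"
  and written_state [simp]: "written (state c s i w) = w"
  by (simp_all add: state_def written_def)

text \<open>
  The arguments are the closure in head position, the stack, the input and the output. Where the
  machine would be stuck, for instance on an empty stack, the result is some meaningless code. Input
  and output are pairs of a value and \<open>2\<close> to the length of the string, see \<open>bits_code\<close>: a bit is read
  by comparing the value with half that power, and written by adding the power. A closure with the tag
  8 of \<open>End\<close> counts as halted.
\<close>
definition transition :: "nat \<Rightarrow> nat \<Rightarrow> nat \<Rightarrow> nat \<Rightarrow> nat" where
  "transition c s i w =
    (if tag c = 0 then if arg c = 0 then state (head (right c)) s i w
                       else state (pair (pair 0 (arg c - 1)) (tail (right c))) s i w
     else if tag c = 1 then state (pair (arg c) (Suc (pair (head s) (right c)))) (tail s) i w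
     else if tag c = 2 then state (pair (left (arg c)) (right c))
       (Suc (pair (pair (right (arg c)) (right c)) s)) i w
     else if tag c = 3 then state (head s) (Suc (pair (pair (pair 4 (tail s)) 0) (tail s))) i w
     else if tag c = 4 then state (head s) (arg c) i w
     else if tag c = 5 then
       if right i = 1 then state (head (tail (tail s))) (tail (tail (tail s))) i w
       else if right i div 2 - left i = 0 then state (head (tail s)) (tail (tail (tail s)))
         (pair (left i - right i div 2) (right i div 2)) w
       else state (head s) (tail (tail (tail s))) (pair (left i) (right i div 2)) w
     else if tag c = 6 then
       state (head s) (tail s) i (pair (right w + left w) (2 * right w))
     else if tag c = 7 then state (head s) (tail s) i (pair (left w) (2 * right w))
     else state c s i w)"

definition step :: "nat \<Rightarrow> nat" where
  "step z = transition (left z) (left (right z)) (left (right (right z))) (written z)"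

lemma step_state: "step (state c s i w) = transition c s i w"
  by (simp add: step_def) (simp add: state_def)

lemma step_halted: "tag (left z) = 8 \<Longrightarrow> left (step z) = left z \<and> written (step z) = written z"
  by (simp add: step_def transition_def)

lemma rec_fun_tag: "rec_fun k F \<Longrightarrow> rec_fun k (\<lambda>xs. tag (F xs))"
  and rec_fun_arg: "rec_fun k F \<Longrightarrow> rec_fun k (\<lambda>xs. arg (F xs))"
  and rec_fun_head: "rec_fun k F \<Longrightarrow> rec_fun k (\<lambda>xs. head (F xs))"
  and rec_fun_tail: "rec_fun k F \<Longrightarrow> rec_fun k (\<lambda>xs. tail (F xs))"
  and rec_fun_written: "rec_fun k F \<Longrightarrow> rec_fun k (\<lambda>xs. written (F xs))"
  unfolding tag_def arg_def head_def tail_def written_def by (intro rec_fun_intros; assumption)+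

lemma rec_fun_state:
  "rec_fun k C \<Longrightarrow> rec_fun k S \<Longrightarrow> rec_fun k I \<Longrightarrow> rec_fun k W \<Longrightarrow>
   rec_fun k (\<lambda>xs. state (C xs) (S xs) (I xs) (W xs))"
  unfolding state_def by (intro rec_fun_intros)

lemmas rec_fun_fields = rec_fun_tag rec_fun_arg rec_fun_head rec_fun_tail rec_fun_written rec_fun_state

text \<open>
  The arguments are kept abstract here: each of them occurs many times in the definition.
\<close>
lemma rec_fun_transition:
  assumes "rec_fun k C" "rec_fun k S" "rec_fun k I" "rec_fun k W"
  shows "rec_fun k (\<lambda>xs. transition (C xs) (S xs) (I xs) (W xs))"
  unfolding transition_def by (rule assms rec_fun_fields rec_fun_intros)+

lemma rec_fun_step: "rec_fun1 step"
  unfolding step_def by (rule rec_fun_transition rec_fun_fields rec_fun_intros | simp)+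

text \<open>
  The power of two makes the length recoverable, so leading zeros are not lost.
\<close>
definition bits_code :: "bool list \<Rightarrow> nat" where
  "bits_code bs = pair (val bs) (2 ^ length bs)"

text \<open>
  \<open>Top\<close> is represented by any state about to execute \<open>End\<close>. The \<open>halt\<close> rule is thus simulated by no
  step at all, and the final process by a state that keeps its output forever.
\<close>
inductive simulates :: "nat \<Rightarrow> exec_context \<Rightarrow> bool" where
  running: "represents c t \<Longrightarrow> list_all2 represents cs \<pi>
    \<Longrightarrow> simulates (state c (list_code cs) (bits_code i) (bits_code w)) (t \<star> \<pi>, i, w)"
| finished: "tag c = 8 \<Longrightarrow> simulates (state c s (bits_code i) (bits_code w)) (Top, i, w)"

text \<open>
  The closure found for a variable may have a variable as its term again. This comes to an end because
  the closures of an environment are smaller than the closure they belong to, which is the rule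
  induction.
\<close>
lemma resolve_variable:
  "represents c t \<Longrightarrow>
   \<exists>k c'. (step ^^ k) (state c s i w) = state c' s i w \<and> represents c' t \<and> tag c' \<noteq> 0"
proof (induction rule: represents.induct)
  case (closure es us t)
  have rep: "represents (pair (enc t) (list_code es)) (inst 0 us t)"
    using closure by (intro represents.closure) (auto simp: list_all2_conv_all_nth)
  show ?case
  proof (cases "\<exists>j. t = Var j")
    case False
    then have "tag (pair (enc t) (list_code es)) \<noteq> 0" by (cases t) auto
    with rep show ?thesis
      by (intro exI[of _ 0] exI[of _ "pair (enc t) (list_code es)"]) simp
  next
    case True
    then obtain j where Var: "t = Var j" by blast
    with closure.hyps have j: "j < length us" by simp
    have look: "(step ^^ Suc j) (state (pair (pair 0 j) (list_code es)) s i w) = state (es ! j) s i w"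
      if "j < length es" for j es
      using that
    proof (induction j arbitrary: es)
      case 0
      then show ?case by (cases es) (auto simp: step_state transition_def)
    next
      case (Suc j)
      then obtain x xs where "es = x # xs" "j < length xs" by (cases es) auto
      with Suc.IH[of xs] show ?case
        by (simp add: step_state transition_def del: funpow.simps add: funpow_Suc_right[of "Suc j"])
    qed
    have len: "length es = length us" using closure.IH by (simp add: list_all2_lengthD)
    with closure.IH j obtain k c' where
      "(step ^^ k) (state (es ! j) s i w) = state c' s i w" "represents c' (us ! j)" "tag c' \<noteq> 0"
      by (auto simp: list_all2_conv_all_nth)
    then have "(step ^^ (k + Suc j)) (state (pair (enc t) (list_code es)) s i w) = state c' s i w"
      using look[of j es] j len unfolding funpow_add by (simp add: Var)
    moreover have "inst 0 us t = us ! j" using j by (simp add: Var)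
    ultimately show ?thesis
      using \<open>represents c' (us ! j)\<close> \<open>tag c' \<noteq> 0\<close> by metis
  qed
next
  case (continuation cs \<pi> e)
  have "represents (pair (pair 4 (list_code cs)) e) (Kont \<pi>)"
    using continuation.IH by (intro represents.continuation) (auto simp: list_all2_conv_all_nth)
  then show ?case
    by (intro exI[of _ 0] exI[of _ "pair (pair 4 (list_code cs)) e"]) simp
qed

text \<open>
  Once the head is no variable, the shape of the represented term determines the tag, whichever of the
  two ways the term is represented in.
\<close>
lemma represents_Lam:
  assumes "represents c (Lam b)" and "tag c \<noteq> 0"
  obtains es us t where "c = pair (pair 1 (enc t)) (list_code es)" "list_all2 represents es us"
    "closed_at (Suc (length us)) t" "b = inst 1 us t"
  using assms(1)
proof cases
  case (closure es us t)
  with assms(2) that show thesis by (cases t) (auto split: if_splits)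
qed

lemma represents_App:
  assumes "represents c (App a b)" and "tag c \<noteq> 0"
  obtains es s t where "c = pair (pair 2 (pair s t)) (list_code es)"
    "represents (pair s (list_code es)) a" "represents (pair t (list_code es)) b"
  using assms(1)
proof cases
  case (closure es us t)
  with assms(2) show thesis by (cases t) (auto intro!: that represents.closure split: if_splits)
qed

lemma represents_Kont:
  assumes "represents c (Kont \<pi>)" and "tag c \<noteq> 0"
  shows "tag c = 4 \<and> (\<exists>cs. arg c = list_code cs \<and> list_all2 represents cs \<pi>)"
  using assms(1)
proof cases
  case (closure es us t)
  with assms(2) show ?thesis by (cases t) (auto intro!: exI represents_enc_all split: if_splits)
qed auto

lemma represents_constant:
  assumes "represents c t" and "tag c \<noteq> 0"
  shows "t = Cc \<Longrightarrow> tag c = 3" "t = Rd \<Longrightarrow> tag c = 5" "t = Wr1 \<Longrightarrow> tag c = 6"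
    "t = Wr0 \<Longrightarrow> tag c = 7" "t = End \<Longrightarrow> tag c = 8"
proof -
  have "(t = Cc \<longrightarrow> tag c = 3) \<and> (t = Rd \<longrightarrow> tag c = 5) \<and> (t = Wr1 \<longrightarrow> tag c = 6)
    \<and> (t = Wr0 \<longrightarrow> tag c = 7) \<and> (t = End \<longrightarrow> tag c = 8)"
    using assms(1)
  proof cases
    case (closure es us u)
    with assms(2) show ?thesis by (cases u) (auto split: if_splits)
  qed auto
  then show "t = Cc \<Longrightarrow> tag c = 3" "t = Rd \<Longrightarrow> tag c = 5" "t = Wr1 \<Longrightarrow> tag c = 6"
    "t = Wr0 \<Longrightarrow> tag c = 7" "t = End \<Longrightarrow> tag c = 8" by auto
qed

lemma transition_simulates:
  assumes x: "(t \<star> \<pi>, i, w) \<leadsto> y" and t: "represents c t" "tag c \<noteq> 0"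
    and \<pi>: "list_all2 represents cs \<pi>"
  shows "\<exists>k. simulates ((step ^^ k) (state c (list_code cs) (bits_code i) (bits_code w))) y"
proof -
  have one: ?thesis
    if "simulates (transition c (list_code cs) (bits_code i) (bits_code w)) y"
    using that by (intro exI[of _ 1]) (simp add: step_state)
  note tag = represents_constant[OF t]
  show ?thesis
    using x
  proof cases
    case (evaluate u \<rho>)
    from evaluate(2) show ?thesis
    proof cases
      case (push v)
      from represents_App[OF t[unfolded push]] obtain es a b where
        "c = pair (pair 2 (pair a b)) (list_code es)"
        "represents (pair a (list_code es)) u" "represents (pair b (list_code es)) v" .
      then show ?thesis
        using simulates.running[of "pair a (list_code es)" u "pair b (list_code es) # cs" "v # \<pi>" i w] \<pi>
        by (intro one) (simp add: transition_def evaluate(1) push)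
    next
      case (grab b v)
      from represents_Lam[OF t[unfolded grab]] obtain es us a where a:
        "c = pair (pair 1 (enc a)) (list_code es)" "list_all2 represents es us"
        "closed_at (Suc (length us)) a" "b = inst 1 us a" .
      from \<pi> obtain d ds where d: "cs = d # ds" "represents d v" "list_all2 represents ds \<rho>"
        unfolding grab list_all2_Cons2 by blast
      from a d have "represents (pair (enc a) (list_code (d # es))) (inst 0 (v # us) a)"
        by (intro represents.closure) auto
      also have "inst 0 (v # us) a = u"
        using a subst_inst[of 0 us a v] represents_all_closed by (simp add: grab)
      finally show ?thesis
        using simulates.running[of _ u ds \<rho> i w] a d
        by (intro one) (simp add: transition_def evaluate(1))
    next
      case (save \<rho>')
      then obtain d ds where d: "cs = d # ds" "represents d u" "list_all2 represents ds \<rho>'"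
        using \<pi> unfolding save list_all2_Cons2 by blast
      have "represents (pair (pair 4 (list_code ds)) 0) (Kont \<rho>')"
        using d(3) by (rule represents.continuation)
      then show ?thesis
        using simulates.running[of d u "pair (pair 4 (list_code ds)) 0 # ds" \<rho> i w] tag(1) d save
        by (intro one) (simp add: transition_def evaluate(1))
    next
      case (restore \<rho>')
      then obtain d ds where d: "cs = d # ds" "represents d u"
        using \<pi> unfolding restore list_all2_Cons2 by blast
      from represents_Kont[OF t[unfolded restore]] obtain rs where
        "tag c = 4" "arg c = list_code rs" "list_all2 represents rs \<rho>" by blast
      then show ?thesis
        using simulates.running[of d u rs \<rho> i w] d
        by (intro one) (simp add: transition_def evaluate(1))
    qed
  next
    case (read0 t0 t1 t2 \<rho> bs)
    then obtain c0 c1 c2 ds where d: "cs = c0 # c1 # c2 # ds" "represents c0 t0" "list_all2 represents ds \<rho>"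
      using \<pi> by (auto simp: list_all2_Cons2)
    show ?thesis
      using simulates.running[OF d(2,3), of bs w] tag(2) d read0 val_less[of bs]
      by (intro one) (simp add: transition_def bits_code_def)
  next
    case (read1 t0 t1 t2 \<rho> bs)
    then obtain c0 c1 c2 ds where d: "cs = c0 # c1 # c2 # ds" "represents c1 t1" "list_all2 represents ds \<rho>"
      using \<pi> by (auto simp: list_all2_Cons2)
    show ?thesis
      using simulates.running[OF d(2,3), of bs w] tag(2) d read1
      by (intro one) (simp add: transition_def bits_code_def)
  next
    case (read_empty t0 t1 t2 \<rho>)
    then obtain c0 c1 c2 ds where d: "cs = c0 # c1 # c2 # ds" "represents c2 t2" "list_all2 represents ds \<rho>"
      using \<pi> by (auto simp: list_all2_Cons2)
    show ?thesis
      using simulates.running[OF d(2,3), of "[]" w] tag(2) d read_empty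
      by (intro one) (simp add: transition_def bits_code_def)
  next
    case (write0 t0 \<rho>)
    then obtain d ds where d: "cs = d # ds" "represents d t0" "list_all2 represents ds \<rho>"
      using \<pi> by (auto simp: list_all2_Cons2)
    show ?thesis
      using simulates.running[OF d(2,3), of i "False # w"] tag(4) d write0
      by (intro one) (simp add: transition_def bits_code_def)
  next
    case (write1 t0 \<rho>)
    then obtain d ds where d: "cs = d # ds" "represents d t0" "list_all2 represents ds \<rho>"
      using \<pi> by (auto simp: list_all2_Cons2)
    show ?thesis
      using simulates.running[OF d(2,3), of i "True # w"] tag(3) d write1
      by (intro one) (simp add: transition_def bits_code_def)
  next
    case halt
    then show ?thesis using tag(5) simulates.finished by (intro exI[of _ 0]) auto
  qed
qed

lemma step_simulates:
  assumes "x \<leadsto> y" and "simulates z x"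
  shows "\<exists>k. simulates ((step ^^ k) z) y"
  using assms(2)
proof cases
  case (running c t cs \<pi> i w)
  from resolve_variable[OF running(3)] obtain k c' where
    "(step ^^ k) z = state c' (list_code cs) (bits_code i) (bits_code w)"
    "represents c' t" "tag c' \<noteq> 0" unfolding running(1) by blast
  with transition_simulates[of t \<pi> i w y c' cs] assms(1) running obtain l where
    "simulates ((step ^^ l) ((step ^^ k) z)) y" by metis
  then have "simulates ((step ^^ (l + k)) z) y" by (simp add: funpow_add)
  then show ?thesis by blast
next
  case (finished c s i w)
  with assms(1) show ?thesis by (auto elim: executes.cases)
qed

lemma run_simulates:
  "x \<leadsto>\<^sup>* y \<Longrightarrow> simulates z x \<Longrightarrow> \<exists>k. simulates ((step ^^ k) z) y"
proof (induction rule: rtranclp_induct)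
  case base
  then show ?case by (intro exI[of _ 0]) simp
next
  case (step x' y')
  then obtain k l where "simulates ((step ^^ l) ((step ^^ k) z)) y'"
    using step_simulates by metis
  then show ?case by (metis funpow_add comp_apply)
qed

section \<open>Searching for a halting computation\<close>

text \<open>Determinism lets a code define a partial function.\<close>
lemma rec_eval_deterministic: "rec_eval c xs y \<Longrightarrow> rec_eval c xs z \<Longrightarrow> y = z"
proof (induction arbitrary: z rule: rec_eval.induct)
  case (zero xs)
  then show ?case by cases simp
next
  case (succ x)
  then show ?case by cases simp
next
  case (proj i xs)
  from proj.prems show ?case by cases simp
next
  case (comp xs gs ys h w)
  from comp.prems obtain ys' where "list_all2 (\<lambda>g y. rec_eval g xs y) gs ys'" "rec_eval h ys' z"
    by cases blast
  moreover from this(1) comp.IH(1) have "ys' = ys"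
    by (auto simp: list_all2_conv_all_nth intro!: nth_equalityI)
  ultimately show ?case using comp.IH(2) by simp
next
  case (primrec_0 g xs y h)
  from primrec_0.prems show ?case by cases (rule primrec_0.IH)
next
  case (primrec_Suc g h n xs y w)
  note IH = primrec_Suc.IH
  from primrec_Suc.prems show ?case
  proof cases
    case (primrec_Suc y')
    then show ?thesis using IH by metis
  qed
next
  case (mu g n xs)
  from mu.prems have "rec_eval g (z # xs) 0" "\<forall>m<z. \<exists>k. rec_eval g (m # xs) (Suc k)"
    by (cases, simp)+
  with mu.IH show ?case by (metis nat_neq_iff nat.distinct(1))
qed

text \<open>Kleene's normal form: one minimisation, of \<open>H\<close>, between total recursive functions.\<close>
lemma partial_recursive_search:
  assumes H: "rec_fun2 H" and U: "rec_fun2 U"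
  obtains g where "partial_recursive g"
    and "\<And>n k. H k n = 0 \<Longrightarrow> \<forall>j<k. H j n \<noteq> 0 \<Longrightarrow> g n = Some (U k n)"
proof -
  obtain h u where h: "\<And>k n. rec_eval h [k, n] (H k n)" and u: "\<And>k n. rec_eval u [k, n] (U k n)"
  proof -
    from H obtain h where "\<forall>xs. length xs = 2 \<longrightarrow> rec_eval h xs (H (xs ! 0) (xs ! 1))"
      unfolding rec_fun_def by blast
    then have "rec_eval h [k, n] (H k n)" for k n by (auto dest: spec[of _ "[k, n]"])
    moreover from U obtain u where "\<forall>xs. length xs = 2 \<longrightarrow> rec_eval u xs (U (xs ! 0) (xs ! 1))"
      unfolding rec_fun_def by blast
    then have "rec_eval u [k, n] (U k n)" for k n by (auto dest: spec[of _ "[k, n]"])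
    ultimately show thesis by (rule that)
  qed
  define c where "c = Comp u [Mu h, Proj 0]"
  define g where "g n = (if \<exists>m. rec_eval c [n] m then Some (THE m. rec_eval c [n] m) else None)" for n
  have g: "g n = Some m \<longleftrightarrow> rec_eval c [n] m" for n m
    unfolding g_def using rec_eval_deterministic theI[of "rec_eval c [n]"] by auto
  show thesis
  proof
    show "partial_recursive g" unfolding partial_recursive_def using g by blast
    fix n k assume k: "H k n = 0" "\<forall>j<k. H j n \<noteq> 0"
    have "rec_eval h [k, n] 0" using h[of k n] k by simp
    moreover have "\<forall>j<k. \<exists>y. rec_eval h [j, n] (Suc y)" using h k by (metis not0_implies_Suc)
    ultimately have "rec_eval (Mu h) [n] k" by (rule rec_eval.mu)
    moreover have "rec_eval (Proj 0) [n] n" using rec_eval.proj[of 0 "[n]"] by simp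
    ultimately have "rec_eval c [n] (U k n)" unfolding c_def
      using u by (intro rec_eval.comp[where ys = "[k, n]"]) auto
    then show "g n = Some (U k n)" by (simp add: g)
  qed
qed

text \<open>
  The input is coded together with 2 to its length, the least power of two above \<open>n\<close>. It doubles
  exactly when \<open>n\<close> reaches it.
\<close>
fun width :: "nat \<Rightarrow> nat" where
  "width 0 = 1"
| "width (Suc n) = (if Suc n = width n then 2 * width n else width n)"

lemma width_bin: "width n = 2 ^ length (bin n)"
proof (induction n)
  case 0
  show ?case by (simp add: bin.simps)
next
  case (Suc n)
  have rec: "2 ^ length (bin n) = (2 :: nat) * 2 ^ length (bin (n div 2))" if "n > 0" for n
    using that by (subst bin.simps) simp
  have "(2 :: nat) ^ length (bin (Suc n)) =
     (if Suc n = 2 ^ length (bin n) then 2 * 2 ^ length (bin n) else 2 ^ length (bin n))" for n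
  proof (induction n rule: less_induct)
    case (less n)
    show ?case
    proof (cases "n = 0")
      case True
      then show ?thesis by (simp add: rec bin.simps[of 0])
    next
      case False
      show ?thesis
      proof (cases "even n")
        case True
        moreover from this have "Suc n \<noteq> 2 * m" for m by presburger
        moreover from True have "Suc n div 2 = n div 2" by presburger
        ultimately show ?thesis using False rec[of n] rec[of "Suc n"] by auto
      next
        case odd: False
        then have half: "Suc n div 2 = Suc (n div 2)" "Suc n = 2 * Suc (n div 2)" by presburger+
        have bin_Suc: "(2 :: nat) ^ length (bin (Suc n)) = 2 * 2 ^ length (bin (Suc (n div 2)))"
          using rec[of "Suc n"] unfolding half(1) by simp
        have bin_n: "(2 :: nat) ^ length (bin n) = 2 * 2 ^ length (bin (n div 2))"
          using False by (intro rec) simp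
        have IH: "2 ^ length (bin (Suc (n div 2))) =
           (if Suc (n div 2) = 2 ^ length (bin (n div 2)) then 2 * 2 ^ length (bin (n div 2))
            else (2 :: nat) ^ length (bin (n div 2)))"
          using False by (intro less.IH) simp
        have "(Suc n = 2 * 2 ^ length (bin (n div 2))) =
            (Suc (n div 2) = 2 ^ length (bin (n div 2)))"
          unfolding half(2) by (simp del: mult_Suc_right)
        then show ?thesis unfolding bin_Suc bin_n IH by (simp only: if_distrib[of "(*) 2"])
      qed
    qed
  qed
  with Suc.IH show ?case by simp
qed

lemma rec_fun_width: "rec_fun1 width"
proof (rule rec_fun_rec1)
  show "rec_fun2 (\<lambda>n y. if Suc n = y then 2 * y else y)" by (intro rec_fun_intros) simp_all
qed simp_all

lemma initial_simulates:
  assumes "p \<in> processes"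
  obtains c s where "\<And>i w. simulates (state c s (bits_code i) (bits_code w)) (p, i, w)"
proof (cases p)
  case (Proc t \<pi>)
  with assms have "closed_at 0 t" "\<forall>u\<in>set \<pi>. closed_at 0 u"
    by (auto simp: processes_def stacks_def closed_terms_def)
  with that show thesis
    unfolding Proc using simulates.running[OF represents_enc represents_enc_all] by blast
next
  case Top
  have "tag (pair (pair 8 0) 0) = 8" by simp
  from that[unfolded Top, OF simulates.finished[OF this]] show thesis by blast
qed

text \<open>
  A run of \<open>p\<close> on \<open>bin n\<close> that reaches \<open>Top\<close> shows only that some number of steps leads to a halted
  state, while the search finds the least such number. Both states have the same output, because a
  halted state keeps it.
\<close>
lemma implements_computable:
  assumes "p \<in> processes" and "implements p f"
  shows "computable f"
proof -
  obtain c s where init: "\<And>i w. simulates (state c s (bits_code i) (bits_code w)) (p, i, w)"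
    using initial_simulates[OF assms(1)] by blast
  define run where "run k n = (step ^^ k) (state c s (pair n (width n)) (pair 0 1))" for k n
  have run: "rec_fun2 run"
  proof (rule rec_fun_rec2)
    show "rec_fun1 (\<lambda>n. state c s (pair n (width n)) (pair 0 1))"
      by (intro rec_fun_intros rec_fun_fields rec_fun_app1[OF rec_fun_width]) simp_all
    show "rec_fun 3 (\<lambda>xs. step (xs ! 1))"
      by (intro rec_fun_app1[OF rec_fun_step] rec_fun_nth) simp
  qed (simp_all add: run_def)
  define H where "H k n = (if tag (left (run k n)) = 8 then 0 else 1 :: nat)" for k n
  have "rec_fun2 H" unfolding H_def
    by (intro rec_fun_intros rec_fun_fields rec_fun_app2[OF run]) simp_all
  moreover have "rec_fun2 (\<lambda>k n. left (written (run k n)))"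
    by (intro rec_fun_intros rec_fun_fields rec_fun_app2[OF run]) simp_all
  ultimately obtain g where g: "partial_recursive g" and
    g_eq: "\<And>n k. H k n = 0 \<Longrightarrow> \<forall>j<k. H j n \<noteq> 0 \<Longrightarrow> g n = Some (left (written (run k n)))"
    by (rule partial_recursive_search) blast
  have "g n = Some m" if fn: "f n = Some m" for n m
  proof -
    have "simulates (run 0 n) (p, bin n, [])"
      using init[of "bin n" "[]"] by (simp add: run_def bits_code_def width_bin val_bin)
    moreover have "(p, bin n, []) \<leadsto>\<^sup>* (Top, [], bin m)"
      using assms(2) fn by (simp add: implements_def)
    ultimately obtain k where "simulates ((step ^^ k) (run 0 n)) (Top, [], bin m)"
      using run_simulates by blast
    then have "simulates (run k n) (Top, [], bin m)" by (simp add: run_def)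
    then have k: "H k n = 0" "left (written (run k n)) = m"
      by (cases; auto simp: H_def bits_code_def val_bin)+
    define l where "l = (LEAST l. H l n = 0)"
    have l: "H l n = 0" "l \<le> k" "\<forall>j<l. H j n \<noteq> 0"
      unfolding l_def using k LeastI Least_le not_less_Least by (metis (mono_tags, lifting))+
    from l(1) have tag_l: "tag (left (run l n)) = 8" by (simp add: H_def split: if_splits)
    have "tag (left (run (d + l) n)) = 8 \<and> written (run (d + l) n) = written (run l n)" for d
    proof (induction d)
      case 0
      show ?case using tag_l by simp
    next
      case (Suc d)
      moreover have "run (Suc d + l) n = step (run (d + l) n)" by (simp add: run_def)
      ultimately show ?case by (simp add: step_halted)
    qed
    from this[of "k - l"] l(2) have "written (run k n) = written (run l n)" by simp
    with g_eq[OF l(1,3)] k(2) show ?thesis by simp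
  qed
  then have "f \<subseteq>\<^sub>m g" by (auto simp: map_le_def dom_def)
  with g show ?thesis unfolding computable_def by blast
qed

theorem theorem28:
  fixes f :: "nat \<rightharpoonup> nat"
  shows "(consistent (implementations f) \<longleftrightarrow> f \<noteq> Map.empty)
       \<and> (implementations f \<noteq> {} \<longleftrightarrow> computable f)"
  using consistent_implementations_iff computable_implementations implements_computable
  unfolding implementations_def by blast

end
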